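(* Let $G=(A\cup B,E)$ be a connected, reduced bipartite graph with partite sets $A=\{a_1,\dots,a_m\}$ and $B=\{b_1,\dots,b_n\}$, $m\le n$. If $m$ is odd, adjoin a new vertex $a_{m+1}$ to $A$ with $N(a_{m+1})=\varnothing$ and replace $m$ by $m+1$; so assume below that $m$ is even, and let $G'$ denote $G$ if $m$ was even and $G$ together with the isolated vertex $a_{m+1}$ if $m$ was odd. Group $A$ into the pairs $(a_1,a_2),(a_3,a_4),\dots,(a_{m-1},a_m)$. For each pair $(a_i,a_j)=(a_{2s-1},a_{2s})$, let $$w_{(i,j)} = B_{*i}\, a_i\, B_i\, a_j\, w'_{(i,j)}\, a_i\, B'_j\, a_j\, B'_{*j},$$ where $B_i$ is any permutation of $N(a_i)\setminus N(a_j)$, $w'_{(i,j)}$ is any permutation of $N(a_i)\cap N(a_j)$, $B'_j$ is any permutation of $N(a_j)\setminus N(a_i)$, and $B_{*i}B'_{*j}$ (concatenation) is any permutation of $B\setminus (N(a_i)\cup N(a_j))$. For $s=1,\dots,\frac m2$, let $D_s$ be the word obtained as follows: remove the pair $(a_{2s-1},a_{2s})$ and the next pair cyclically, i.e. $(a_{2s+1},a_{2s+2})$ if $s<\frac m2$ and $(a_1,a_2)$ if $s=\frac m2$; then $D_s$ is the word listing the second components $a_{2t}$ of the remaining pairs in increasing order of $t$, followed by the first components $a_{2t-1}$ of the remaining pairs in increasing order of $t$. Let $$w_0 = a_2\, a_1\, \bigl(w_{(1,2)}^R\bigr)|_B\, a_4\, a_3\, \cdots\, a_m\, a_{m-1},$$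 where $u^R$ denotes the reversal of a word $u$ and $u|_B$ the subword of $u$ consisting of the letters in $B$. Finally let $$w = w_{(1,2)}\, D_1\, w_{(3,4)}\, D_2\, w_{(5,6)}\, D_3 \cdots w_{(m-1,m)}\, D_{m/2}\, w_0 .$$ Then $w$ (a $(1+\frac m2)$-uniform word over the vertex set of $G'$) represents $G'$; i.e. for any two distinct vertices $x,y$ of $G'$, $x$ and $y$ are adjacent in $G'$ if and only if $x$ and $y$ alternate in $w$.
   Context: A word over a finite set is a finite sequence of its elements. For a word $w$ and a subset $S$, $w|_S$ is the subword obtained by deleting all letters not in $S$. Letters $x,y$ alternate in $w$ if $w|_{\{x,y\}}$ is of the form $xyxy\cdots$ or $yxyx\cdots$ (even or odd length). A word $w$ represents a graph if the vertices are exactly the letters of $w$ and two vertices are adjacent iff they alternate in $w$. A word is $k$-uniform if every letter occurs exactly $k$ times. $N(x)$ denotes the neighborhood of vertex $x$. A graph is reduced if no two vertices have the same neighborhood. The blocks $B_{*i},B_i,w'_{(i,j)},B'_j,B'_{*j}$ may be empty.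
   Formalization: The formal theorem adds the assumption m ≥ 3 for the original m (at least two pairs); for m = 1 or 2 the claim is false, since w restricted to a_1 and a neighbour b is a_1 b a_1 a_1 b, and for m = 0 the word w_0 is undefined. *)

theory Defs
  imports "Graph_Theory.Graph_Theory" "HOL-Combinatorics.Multiset_Permutations"
begin

text \<open>Finite simple graphs are the symmetric, loop-free pair digraphs of
  \<^locale>\<open>pair_graph\<close>; words over \<open>'v\<close> are lists.\<close>

definition nbhd :: "'v pair_pre_digraph \<Rightarrow> 'v \<Rightarrow> 'v set" where
  "nbhd G x = {y. (x, y) \<in> parcs G}"

definition reduced :: "'v pair_pre_digraph \<Rightarrow> bool" where
  "reduced G \<longleftrightarrow> (\<forall>x\<in>pverts G. \<forall>y\<in>pverts G. x \<noteq> y \<longrightarrow> nbhd G x \<noteq> nbhd G y)"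

definition bipartite_with :: "'v pair_pre_digraph \<Rightarrow> 'v set \<Rightarrow> 'v set \<Rightarrow> bool" where
  "bipartite_with G A B \<longleftrightarrow> pverts G = A \<union> B \<and> A \<inter> B = {} \<and>
     (\<forall>(x, y)\<in>parcs G. (x \<in> A \<and> y \<in> B) \<or> (x \<in> B \<and> y \<in> A))"

definition add_isolated :: "'v \<Rightarrow> 'v pair_pre_digraph \<Rightarrow> 'v pair_pre_digraph" where
  "add_isolated v G = G\<lparr>pverts := insert v (pverts G)\<rparr>"

definition restrict_word :: "'v list \<Rightarrow> 'v set \<Rightarrow> 'v list" where
  "restrict_word w S = filter (\<lambda>x. x \<in> S) w"

text \<open>The word \<open>x y x y \<dots>\<close> with \<open>k\<close> letters.\<close>

fun alt_word :: "'v \<Rightarrow> 'v \<Rightarrow> nat \<Rightarrow> 'v list" where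
  "alt_word x y 0 = []"
| "alt_word x y (Suc k) = x # alt_word y x k"

definition alternate :: "'v list \<Rightarrow> 'v \<Rightarrow> 'v \<Rightarrow> bool" where
  "alternate w x y \<longleftrightarrow>
     (\<exists>k. restrict_word w {x, y} = alt_word x y k \<or> restrict_word w {x, y} = alt_word y x k)"

definition represents :: "'v list \<Rightarrow> 'v pair_pre_digraph \<Rightarrow> bool" where
  "represents w G \<longleftrightarrow> set w = pverts G \<and>
     (\<forall>x\<in>pverts G. \<forall>y\<in>pverts G. x \<noteq> y \<longrightarrow> ((x, y) \<in> parcs G \<longleftrightarrow> alternate w x y))"

definition uniform_word :: "nat \<Rightarrow> 'v list \<Rightarrow> bool" where
  "uniform_word k w \<longleftrightarrow> (\<forall>x\<in>set w. count_list w x = k)"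

text \<open>In the following, \<open>a\<close> enumerates the even-sized part from index 1, and \<open>h\<close> is the
  number of pairs; pair number \<open>s \<in> {1..h}\<close> is \<open>(a (2 * s - 1), a (2 * s))\<close>. The families
  \<open>P, Q, R, S, T\<close> give, for each pair \<open>(a\<^sub>i, a\<^sub>j)\<close>, the blocks
  \<open>B\<^sub>*\<^sub>i, B\<^sub>i, w'\<^bsub>(i,j)\<^esub>, B'\<^sub>j, B'\<^sub>*\<^sub>j\<close> in this order.\<close>

definition pair_blocks ::
  "'v pair_pre_digraph \<Rightarrow> 'v set \<Rightarrow> 'v \<Rightarrow> 'v \<Rightarrow>
   'v list \<Rightarrow> 'v list \<Rightarrow> 'v list \<Rightarrow> 'v list \<Rightarrow> 'v list \<Rightarrow> bool" where
  "pair_blocks G B x y p q r s t \<longleftrightarrow>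
     q \<in> permutations_of_set (nbhd G x - nbhd G y) \<and>
     r \<in> permutations_of_set (nbhd G x \<inter> nbhd G y) \<and>
     s \<in> permutations_of_set (nbhd G y - nbhd G x) \<and>
     p @ t \<in> permutations_of_set (B - (nbhd G x \<union> nbhd G y))"

definition pair_word ::
  "'v \<Rightarrow> 'v \<Rightarrow> 'v list \<Rightarrow> 'v list \<Rightarrow> 'v list \<Rightarrow> 'v list \<Rightarrow> 'v list \<Rightarrow> 'v list" where
  "pair_word x y p q r s t = p @ [x] @ q @ [y] @ r @ [x] @ s @ [y] @ t"

text \<open>For \<open>h = 1\<close> the cyclically next pair is the pair itself; then \<open>a 1\<close> occurs three times in the
  word below and every neighbour of \<open>a 1\<close> only twice, with pattern \<open>a\<^sub>1 b a\<^sub>1 a\<^sub>1 b\<close>, so the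
  construction represents the graph only from \<open>h = 2\<close> on.\<close>

definition remaining_pairs :: "nat \<Rightarrow> nat \<Rightarrow> nat list" where
  "remaining_pairs h s = filter (\<lambda>t. t \<noteq> s \<and> t \<noteq> (if s < h then s + 1 else 1)) [1..<h + 1]"

definition D_word :: "(nat \<Rightarrow> 'v) \<Rightarrow> nat \<Rightarrow> nat \<Rightarrow> 'v list" where
  "D_word a h s =
     map (\<lambda>t. a (2 * t)) (remaining_pairs h s) @ map (\<lambda>t. a (2 * t - 1)) (remaining_pairs h s)"

definition last_word :: "(nat \<Rightarrow> 'v) \<Rightarrow> nat \<Rightarrow> 'v set \<Rightarrow> 'v list \<Rightarrow> 'v list" where
  "last_word a h B w12 =
     [a 2, a 1] @ restrict_word (rev w12) B @ concat (map (\<lambda>t. [a (2 * t), a (2 * t - 1)]) [2..<h + 1])"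

definition full_word ::
  "(nat \<Rightarrow> 'v) \<Rightarrow> nat \<Rightarrow> 'v set \<Rightarrow> (nat \<Rightarrow> 'v list) \<Rightarrow> (nat \<Rightarrow> 'v list) \<Rightarrow>
   (nat \<Rightarrow> 'v list) \<Rightarrow> (nat \<Rightarrow> 'v list) \<Rightarrow> (nat \<Rightarrow> 'v list) \<Rightarrow> 'v list" where
  "full_word a h B P Q R S T =
     (let W = (\<lambda>s. pair_word (a (2 * s - 1)) (a (2 * s)) (P s) (Q s) (R s) (S s) (T s))
      in concat (map (\<lambda>s. W s @ D_word a h s) [1..<h + 1]) @ last_word a h B (W 1))"

end

theory Submission
  imports Defs
begin

text \<open>Two letters alternate iff the restriction of the word to them has no two equal consecutive
  letters. Letters \<open>x\<close>, \<open>y\<close> from different pairs fail this because the word of the pair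
  containing \<open>x\<close> has two occurrences of \<open>x\<close> but none of \<open>y\<close>; the two letters of a pair fail it
  because the word of their pair ends in \<open>a\<^sub>j\<close>, up to other letters, and the next of the two
  letters to occur is again \<open>a\<^sub>j\<close>; two letters of \<open>B\<close> fail it because their order in \<open>w\<^sub>0\<close> is
  opposite to that in the first pair word; and a non-neighbour of \<open>a\<^sub>i\<close> does not separate the
  two occurrences of \<open>a\<^sub>i\<close> in its pair word. For adjacent \<open>x \<in> A\<close> and \<open>b \<in> B\<close>, the block
  consisting of a pair word and the following \<open>D\<close> restricts to \<open>b x\<close>, except for \<open>x b x\<close> at the
  pair of \<open>x\<close> and \<open>b\<close> at the pair cyclically before it.\<close>

section \<open>Alternation as the absence of equal consecutive letters\<close>

lemma hd_alt_word: "k \<noteq> 0 \<Longrightarrow> hd (alt_word x y k) = x"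
  by (cases k) auto

lemma alt_word_eq_Nil_iff [simp]: "alt_word x y k = [] \<longleftrightarrow> k = 0" "[] = alt_word x y k \<longleftrightarrow> k = 0"
  by (cases k; auto)+

lemma distinct_adj_alt_word: "x \<noteq> y \<Longrightarrow> distinct_adj (alt_word x y k)"
  by (induction k arbitrary: x y) (auto simp: distinct_adj_Cons hd_alt_word)

lemma distinct_adj_imp_alt_word:
  assumes "set xs \<subseteq> {x, y}" "distinct_adj xs"
  shows "\<exists>k. xs = alt_word x y k \<or> xs = alt_word y x k"
  using assms
proof (induction xs)
  case Nil
  then show ?case by (intro exI[of _ 0]) simp
next
  case (Cons z zs)
  then have "set zs \<subseteq> {x, y}" "distinct_adj zs"
    by (auto simp: distinct_adj_Cons)
  then obtain k where k: "zs = alt_word x y k \<or> zs = alt_word y x k"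
    using Cons.IH by blast
  show ?case
  proof (cases "k = 0")
    case True
    then show ?thesis using k Cons.prems by (intro exI[of _ 1]) auto
  next
    case False
    then have z: "hd zs \<noteq> z"
      using k Cons.prems by (auto simp: distinct_adj_Cons)
    from k show ?thesis
    proof
      assume zs: "zs = alt_word x y k"
      then have "z = y" using z Cons.prems(1) False by (auto simp: hd_alt_word)
      then have "z # zs = alt_word y x (Suc k)" using zs by simp
      then show ?thesis by blast
    next
      assume zs: "zs = alt_word y x k"
      then have "z = x" using z Cons.prems(1) False by (auto simp: hd_alt_word)
      then have "z # zs = alt_word x y (Suc k)" using zs by simp
      then show ?thesis by blast
    qed
  qed
qed

text \<open>The right-hand side is a local condition and hence passes to contiguous factors of the
  word. This is what allows every failure of alternation to be located in a part of the long
  word.\<close>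

lemma alternate_iff_distinct_adj:
  assumes "x \<noteq> y"
  shows "alternate w x y \<longleftrightarrow> distinct_adj (restrict_word w {x, y})"
proof
  assume "distinct_adj (restrict_word w {x, y})"
  moreover have "set (restrict_word w {x, y}) \<subseteq> {x, y}"
    by (auto simp: restrict_word_def)
  ultimately show "alternate w x y"
    unfolding alternate_def using distinct_adj_imp_alt_word by metis
qed (use assms distinct_adj_alt_word[of x y] distinct_adj_alt_word[of y x]
     in \<open>auto simp: alternate_def\<close>)

lemma alternate_commute: "alternate w x y \<longleftrightarrow> alternate w y x"
  by (auto simp: alternate_def insert_commute)

text \<open>A nonempty alternating run of even length ends in \<open>y\<close>, so another run may
  start with \<open>x\<close> again. This glues the contributions of consecutive blocks.\<close>

lemma alt_word_even_append:
  "alt_word x y (2 * k) @ alt_word x y l = alt_word x y (2 * k + l)"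
  by (induction k) auto

lemma concat_map_const_alt_word:
  "(\<And>s. s \<in> set ss \<Longrightarrow> f s = [x, y]) \<Longrightarrow> concat (map f ss) = alt_word x y (2 * length ss)"
  by (induction ss) auto

section \<open>Restriction and counting of letters\<close>

lemma restrict_word_append [simp]:
  "restrict_word (u @ v) X = restrict_word u X @ restrict_word v X"
  by (simp add: restrict_word_def)

lemma restrict_word_Nil [simp]: "restrict_word [] X = []"
  by (simp add: restrict_word_def)

lemma restrict_word_Cons [simp]:
  "restrict_word (x # u) X = (if x \<in> X then x # restrict_word u X else restrict_word u X)"
  by (simp add: restrict_word_def)

lemma restrict_word_concat: "restrict_word (concat us) X = concat (map (\<lambda>u. restrict_word u X) us)"
  by (induction us) auto

lemma restrict_word_rev: "restrict_word (rev u) X = rev (restrict_word u X)"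
  by (simp add: restrict_word_def rev_filter)

lemma restrict_word_empty: "set u \<inter> X = {} \<Longrightarrow> restrict_word u X = []"
  by (auto simp: restrict_word_def filter_empty_conv)

lemma restrict_word_id: "set u \<subseteq> X \<Longrightarrow> restrict_word u X = u"
  by (auto simp: restrict_word_def intro!: filter_True)

lemma restrict_word_eq_single:
  "distinct u \<Longrightarrow> set u \<inter> X = {x} \<Longrightarrow> restrict_word u X = [x]"
proof (induction u)
  case (Cons z u)
  show ?case
  proof (cases "z \<in> X")
    case True
    then have "z = x" "set u \<inter> X = {}" using Cons.prems by auto
    then show ?thesis using True by (simp add: restrict_word_empty)
  next
    case False
    then show ?thesis using Cons by auto
  qed
qed simp

lemma restrict_word_distinct_pair:
  assumes "distinct u" "x \<in> set u" "y \<in> set u" "x \<noteq> y"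
  shows "restrict_word u {x, y} = [x, y] \<or> restrict_word u {x, y} = [y, x]"
  using assms
proof (induction u)
  case (Cons z u)
  consider "z = x" | "z = y" | "z \<noteq> x" "z \<noteq> y" by blast
  then show ?case
  proof cases
    case 1
    then have "restrict_word u {x, y} = [y]"
      using Cons.prems by (intro restrict_word_eq_single) auto
    then show ?thesis using 1 by simp
  next
    case 2
    then have "restrict_word u {x, y} = [x]"
      using Cons.prems by (intro restrict_word_eq_single) auto
    then show ?thesis using 2 by simp
  next
    case 3
    then show ?thesis using Cons by auto
  qed
qed simp

lemma upt_split_at: "i \<le> t \<Longrightarrow> t < j \<Longrightarrow> [i..<j] = [i..<t] @ t # [t + 1..<j]"
  using upt_add_eq_append[of i t "j - t"] by (simp add: upt_conv_Cons)

lemma count_list_concat: "count_list (concat us) x = (\<Sum>u\<leftarrow>us. count_list u x)"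
  by (induction us) auto

lemma count_list_distinct: "distinct u \<Longrightarrow> count_list u x = (if x \<in> set u then 1 else 0)"
  by (induction u) auto

lemma count_list_restrict: "x \<in> X \<Longrightarrow> count_list (restrict_word u X) x = count_list u x"
  by (induction u) auto

text \<open>Here \<open>G\<close> is the graph after the parity adjustment, and the even-sized part
  is given as the range of \<open>a\<close>. The bound \<open>2 \<le> h\<close> makes the cyclic
  successor of a pair differ from the pair itself.\<close>

locale pair_construction =
  fixes G :: "'v pair_pre_digraph" and B :: "'v set" and a :: "nat \<Rightarrow> 'v" and h :: nat
    and P Q R S T :: "nat \<Rightarrow> 'v list"
  assumes two_le_h: "2 \<le> h"
    and inj_a: "inj_on a {1..2 * h}"
    and a_notin_B: "i \<in> {1..2 * h} \<Longrightarrow> a i \<notin> B"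
    and nbhd_subset: "i \<in> {1..2 * h} \<Longrightarrow> nbhd G (a i) \<subseteq> B"
    and blocks: "s \<in> {1..h} \<Longrightarrow>
      pair_blocks G B (a (2 * s - 1)) (a (2 * s)) (P s) (Q s) (R s) (S s) (T s)"
begin

text \<open>Keeps \<open>a 1\<close> from turning into \<open>a (Suc 0)\<close>, so that facts about
  \<open>a 1\<close> still match.\<close>

declare One_nat_def [simp del]

definition W :: "nat \<Rightarrow> 'v list" where
  "W s = pair_word (a (2 * s - 1)) (a (2 * s)) (P s) (Q s) (R s) (S s) (T s)"

abbreviation w :: "'v list" where
  "w \<equiv> full_word a h B P Q R S T"

abbreviation succ :: "nat \<Rightarrow> nat" where
  "succ s \<equiv> if s < h then s + 1 else 1"

lemma w_eq: "w = concat (map (\<lambda>s. W s @ D_word a h s) [1..<h + 1]) @ last_word a h B (W 1)"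
  by (simp add: full_word_def W_def Let_def)

section \<open>Distinctness of the letters\<close>

lemma a_eq_iff: "i \<in> {1..2 * h} \<Longrightarrow> j \<in> {1..2 * h} \<Longrightarrow> a i = a j \<longleftrightarrow> i = j"
  using inj_a by (auto dest: inj_onD)

lemma pair_index_mem:
  "s \<in> {1..h} \<Longrightarrow> 2 * s - 1 \<in> {1..2 * h}" "s \<in> {1..h} \<Longrightarrow> 2 * s \<in> {1..2 * h}"
  by auto

lemma a_pair_eq_iff:
  assumes "s \<in> {1..h}" "t \<in> {1..h}"
  shows "a (2 * s) = a (2 * t) \<longleftrightarrow> s = t" "a (2 * s - 1) = a (2 * t - 1) \<longleftrightarrow> s = t"
    "a (2 * s) \<noteq> a (2 * t - 1)" "a (2 * s - 1) \<noteq> a (2 * t)"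
proof -
  have st: "1 \<le> s" "1 \<le> t" using assms by auto
  note mem = assms[THEN pair_index_mem(1)] assms[THEN pair_index_mem(2)]
  show "a (2 * s) = a (2 * t) \<longleftrightarrow> s = t" "a (2 * s - 1) = a (2 * t - 1) \<longleftrightarrow> s = t"
    "a (2 * s) \<noteq> a (2 * t - 1)" "a (2 * s - 1) \<noteq> a (2 * t)"
    \<comment> \<open>Injectivity turns equations between letters into equations between indices,
      which parity decides. The bounds \<open>st\<close> exclude the index 0, where truncated
      subtraction would give \<open>2 * 0 - 1 = 2 * 0\<close>.\<close>
    unfolding mem[THEN a_eq_iff, OF mem(1)] mem[THEN a_eq_iff, OF mem(2)]
      mem[THEN a_eq_iff, OF mem(3)] mem[THEN a_eq_iff, OF mem(4)]
    using st by presburger+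
qed

text \<open>The final word spells its first pair as \<open>a 2\<close>, \<open>a 1\<close>, so this
  pair has to be compared separately with the general form of a pair.\<close>

lemma a_first_eq_iff:
  assumes "t \<in> {1..h}"
  shows "a 1 = a (2 * t - 1) \<longleftrightarrow> t = 1" "a 2 = a (2 * t) \<longleftrightarrow> t = 1"
    "a 1 \<noteq> a (2 * t)" "a 2 \<noteq> a (2 * t - 1)"
proof -
  have *: "a 1 = a (2 * 1 - 1)" "a 2 = a (2 * 1)" and one: "1 \<in> {1..h}"
    using two_le_h by (simp_all add: One_nat_def)
  show "a 1 = a (2 * t - 1) \<longleftrightarrow> t = 1" "a 2 = a (2 * t) \<longleftrightarrow> t = 1"
    "a 1 \<noteq> a (2 * t)" "a 2 \<noteq> a (2 * t - 1)"
    unfolding * using a_pair_eq_iff[OF one assms] by blast+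
qed

lemma a_pair_notin_B:
  assumes "s \<in> {1..h}"
  shows "a (2 * s - 1) \<notin> B" "a (2 * s) \<notin> B"
  by (intro a_notin_B pair_index_mem assms)+

lemma a_image_disjoint_B: "a ` {1..2 * h} \<inter> B = {}"
  using a_notin_B by blast

lemma set_last_pairs:
  "set (concat (map (\<lambda>t. [a (2 * t), a (2 * t - 1)]) [2..<h + 1])) \<subseteq> a ` {1..2 * h}"
proof -
  have "a (2 * s) \<in> a ` {1..2 * h}" "a (2 * s - 1) \<in> a ` {1..2 * h}" if "s \<in> {1..h}" for s
    using pair_index_mem[OF that] by blast+
  then show ?thesis by auto
qed

text \<open>The blocks follow the Venn diagram of the two neighbourhoods inside \<open>B\<close>:
  \<open>Q\<close>, \<open>R\<close>, \<open>S\<close> fill the three inner regions, while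
  \<open>P\<close> and \<open>T\<close> share the outer one. Hence together they list
  \<open>B\<close> without repetition.\<close>

lemma blocks_distinct:
  assumes "s \<in> {1..h}"
  shows "distinct (P s @ Q s @ R s @ S s @ T s)"
    and "set (P s @ Q s @ R s @ S s @ T s) = B"
    and "set (Q s) = nbhd G (a (2 * s - 1)) - nbhd G (a (2 * s))"
    and "set (R s) = nbhd G (a (2 * s - 1)) \<inter> nbhd G (a (2 * s))"
    and "set (S s) = nbhd G (a (2 * s)) - nbhd G (a (2 * s - 1))"
    and "set (P s) \<union> set (T s) = B - (nbhd G (a (2 * s - 1)) \<union> nbhd G (a (2 * s)))"
proof -
  have *: "nbhd G (a (2 * s - 1)) \<subseteq> B" "nbhd G (a (2 * s)) \<subseteq> B"
    using assms by (auto intro!: nbhd_subset)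
  note b = blocks[OF assms, unfolded pair_blocks_def permutations_of_set_def]
  show "set (Q s) = nbhd G (a (2 * s - 1)) - nbhd G (a (2 * s))"
    and "set (R s) = nbhd G (a (2 * s - 1)) \<inter> nbhd G (a (2 * s))"
    and "set (S s) = nbhd G (a (2 * s)) - nbhd G (a (2 * s - 1))"
    and PT: "set (P s) \<union> set (T s) = B - (nbhd G (a (2 * s - 1)) \<union> nbhd G (a (2 * s)))"
    using b by auto
  then show "set (P s @ Q s @ R s @ S s @ T s) = B"
    using * by auto
  \<comment> \<open>Only the concatenation of \<open>P s\<close> and \<open>T s\<close> is
    specified, so the disjointness of each of them from the other blocks is read off their
    union.\<close>
  have "set (P s) \<inter> (nbhd G (a (2 * s - 1)) \<union> nbhd G (a (2 * s))) = {}"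
    "set (T s) \<inter> (nbhd G (a (2 * s - 1)) \<union> nbhd G (a (2 * s))) = {}"
    using PT by blast+
  then show "distinct (P s @ Q s @ R s @ S s @ T s)"
    using b by auto
qed

text \<open>The permutation of \<open>B\<close> that is left of \<open>W s\<close> when its two
  letters outside \<open>B\<close> are deleted.\<close>

definition U :: "nat \<Rightarrow> 'v list" where
  "U s = P s @ Q s @ R s @ S s @ T s"

lemma distinct_U: "s \<in> {1..h} \<Longrightarrow> distinct (U s)"
  using blocks_distinct(1) by (simp add: U_def)

lemma set_U: "s \<in> {1..h} \<Longrightarrow> set (U s) = B"
  using blocks_distinct(2) by (simp add: U_def)

lemma set_W: "s \<in> {1..h} \<Longrightarrow> set (W s) = insert (a (2 * s - 1)) (insert (a (2 * s)) B)"
  using blocks_distinct(2)[of s] by (auto simp: W_def pair_word_def)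

lemma restrict_W_B:
  assumes "s \<in> {1..h}" "X \<subseteq> B"
  shows "restrict_word (W s) X = restrict_word (U s) X"
proof -
  have "a (2 * s - 1) \<notin> X" "a (2 * s) \<notin> X"
    using assms(2) a_pair_notin_B[OF assms(1)] by auto
  then show ?thesis by (simp add: W_def pair_word_def U_def)
qed

lemma restrict_W_single:
  assumes "s \<in> {1..h}" "b \<in> B"
  shows "restrict_word (W s) {b} = [b]"
proof -
  have "restrict_word (W s) {b} = restrict_word (U s) {b}"
    using assms by (intro restrict_W_B) auto
  also have "\<dots> = [b]"
    using assms distinct_U set_U by (intro restrict_word_eq_single) auto
  finally show ?thesis .
qed

lemma count_W_B: "s \<in> {1..h} \<Longrightarrow> b \<in> B \<Longrightarrow> count_list (W s) b = 1"
  using count_list_restrict[of b "{b}" "W s"] restrict_W_single[of s b] by simp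

section \<open>The words \<open>D_word a h s\<close>\<close>

lemma set_remaining_pairs: "set (remaining_pairs h s) = {t \<in> {1..h}. t \<noteq> s \<and> t \<noteq> succ s}"
  by (auto simp: remaining_pairs_def)

lemma distinct_D: "distinct (D_word a h s)"
proof -
  have "distinct (remaining_pairs h s)" by (simp add: remaining_pairs_def)
  then show ?thesis
    unfolding D_word_def
    by (auto simp: distinct_map set_remaining_pairs a_pair_eq_iff intro!: inj_onI)
qed

lemma D_B: "set (D_word a h s) \<inter> B = {}"
  using a_pair_notin_B by (auto simp: D_word_def set_remaining_pairs)

section \<open>Occurrences of a letter \<open>x\<close> of pair \<open>t\<close>, first or
  second\<close>

context
  fixes t x
  assumes t: "t \<in> {1..h}" and x: "x \<in> {a (2 * t - 1), a (2 * t)}"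
begin

lemma x_notin_B: "x \<notin> B"
  using x a_pair_notin_B[OF t] by auto

lemma x_in_W_iff: "s \<in> {1..h} \<Longrightarrow> x \<in> set (W s) \<longleftrightarrow> s = t"
  using t x x_notin_B by (auto simp: set_W a_pair_eq_iff)

lemma x_in_D_iff: "x \<in> set (D_word a h s) \<longleftrightarrow> t \<noteq> s \<and> t \<noteq> succ s"
proof -
  have "x \<in> set (D_word a h s) \<longleftrightarrow> t \<in> set (remaining_pairs h s)"
  proof -
    have "1 \<le> u \<and> u \<le> h" if "u \<in> set (remaining_pairs h s)" for u
      using that by (simp add: set_remaining_pairs)
    then show ?thesis
      using t x by (auto simp: D_word_def a_pair_eq_iff)
  qed
  then show ?thesis using t by (simp add: set_remaining_pairs)
qed

lemma restrict_W_x: "restrict_word (W t) {x} = [x, x]"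
proof -
  have "x \<notin> set (P t)" "x \<notin> set (Q t)" "x \<notin> set (R t)" "x \<notin> set (S t)" "x \<notin> set (T t)"
    using x_notin_B blocks_distinct(2)[OF t] by auto
  then show ?thesis
    using x t by (auto simp: W_def pair_word_def restrict_word_empty a_pair_eq_iff)
qed

text \<open>The two occurrences of \<open>a (2 * t - 1)\<close> enclose \<open>Q t\<close> and
  \<open>R t\<close>, those of \<open>a (2 * t)\<close> enclose \<open>R t\<close> and
  \<open>S t\<close>; in either case these blocks make up exactly the neighbourhood. A non-neighbour
  lies before both occurrences or after both.\<close>

lemma restrict_W_x_b:
  assumes b: "b \<in> B"
  shows "restrict_word (W t) {x, b} =
    (if b \<in> nbhd G x then [x, b, x] else if b \<in> set (P t) \<or> (x = a (2 * t) \<and> b \<in> set (Q t))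
     then [b, x, x] else [x, x, b])"
proof -
  have r: "restrict_word u {x, b} = (if b \<in> set u then [b] else [])"
    if "distinct u" "set u \<subseteq> B" for u
    using that x_notin_B
    by (auto intro!: restrict_word_empty restrict_word_eq_single)
  note d = blocks_distinct[OF t]
  have ne: "a (2 * t - 1) \<noteq> b" "a (2 * t) \<noteq> b" "a (2 * t) \<noteq> a (2 * t - 1)"
    using b a_pair_notin_B[OF t] a_pair_eq_iff(3)[OF t t] by auto
  have "b \<in> set (P t) \<or> b \<in> set (Q t) \<or> b \<in> set (R t) \<or> b \<in> set (S t) \<or> b \<in> set (T t)"
    using b d(2) by auto
  moreover have rs: "restrict_word (P t) {x, b} = (if b \<in> set (P t) then [b] else [])"
    "restrict_word (Q t) {x, b} = (if b \<in> set (Q t) then [b] else [])"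
    "restrict_word (R t) {x, b} = (if b \<in> set (R t) then [b] else [])"
    "restrict_word (S t) {x, b} = (if b \<in> set (S t) then [b] else [])"
    "restrict_word (T t) {x, b} = (if b \<in> set (T t) then [b] else [])"
    by (rule r; use d(1,2) in auto)+
  moreover have nb: "b \<in> nbhd G (a (2 * t - 1)) \<longleftrightarrow> b \<in> set (Q t) \<or> b \<in> set (R t)"
    "b \<in> nbhd G (a (2 * t)) \<longleftrightarrow> b \<in> set (S t) \<or> b \<in> set (R t)"
    using d(3-5) by auto
  ultimately show ?thesis
    using x d(1) ne by (elim disjE insertE emptyE) (auto simp: W_def pair_word_def)
qed

end

section \<open>The final word\<close>

lemma last_word_eq:
  "last_word a h B (W 1) = [a 2, a 1] @ rev (U 1) @
     concat (map (\<lambda>t. [a (2 * t), a (2 * t - 1)]) [2..<h + 1])"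
proof -
  have "restrict_word (rev (W 1)) B = rev (U 1)"
    using restrict_W_B[of 1 B] set_U[of 1] two_le_h
    by (simp add: restrict_word_rev restrict_word_id)
  then show ?thesis by (simp add: last_word_def)
qed

text \<open>Only pair \<open>t\<close> can contribute, and pair 1 is not in the list. Since
  \<open>X\<close> may also contain letters outside the range of \<open>a\<close>, the lemma serves
  both for two letters of a pair and for a letter of a pair with one of \<open>B\<close>.\<close>

lemma restrict_last_pairs:
  assumes t: "t \<in> {1..h}" and X: "X \<inter> a ` {1..2 * h} \<subseteq> {a (2 * t - 1), a (2 * t)}"
  shows "restrict_word (concat (map (\<lambda>t. [a (2 * t), a (2 * t - 1)]) [2..<h + 1])) X =
    (if t = 1 then [] else restrict_word [a (2 * t), a (2 * t - 1)] X)"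
proof -
  have 0: "restrict_word [a (2 * s), a (2 * s - 1)] X = []" if "s \<in> {1..h}" "s \<noteq> t" for s
  proof -
    have "a (2 * s) \<notin> {a (2 * t - 1), a (2 * t)}" "a (2 * s - 1) \<notin> {a (2 * t - 1), a (2 * t)}"
      using that t by (auto simp: a_pair_eq_iff)
    moreover have "a (2 * s) \<in> a ` {1..2 * h}" "a (2 * s - 1) \<in> a ` {1..2 * h}"
      using pair_index_mem[OF that(1)] by blast+
    ultimately have "a (2 * s) \<notin> X" "a (2 * s - 1) \<notin> X"
      using X by blast+
    then show ?thesis by simp
  qed
  have 00: "concat (map (\<lambda>s. restrict_word [a (2 * s), a (2 * s - 1)] X) ss) = []"
    if "set ss \<subseteq> {1..h} - {t}" for ss
    unfolding concat_eq_Nil_conv set_map using that 0 by blast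
  show ?thesis
  proof (cases "t = 1")
    case True
    then have "set [2..<h + 1] \<subseteq> {1..h} - {t}" by auto
    from 00[OF this] show ?thesis
      using True by (simp add: restrict_word_concat comp_def del: restrict_word_Cons)
  next
    case False
    then have split: "[2..<h + 1] = [2..<t] @ t # [t + 1..<h + 1]"
      using t by (intro upt_split_at) auto
    have "set [2..<t] \<subseteq> {1..h} - {t}" "set [t + 1..<h + 1] \<subseteq> {1..h} - {t}"
      using t by auto
    note this[THEN 00]
    then show ?thesis
      unfolding restrict_word_concat map_map comp_def split using False
      by (simp del: restrict_word_Cons concat_eq_Nil_conv)
  qed
qed

lemma distinct_last_blocks:
  "distinct (rev (U 1))" "set (rev (U 1)) = B"
  using distinct_U[of 1] set_U[of 1] two_le_h by auto

lemma restrict_last_a: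
  assumes t: "t \<in> {1..h}" and X: "X \<subseteq> {a (2 * t - 1), a (2 * t)}"
  shows "restrict_word (last_word a h B (W 1)) X = restrict_word [a (2 * t), a (2 * t - 1)] X"
proof -
  have "restrict_word (rev (U 1)) X = []"
    using X distinct_last_blocks(2) a_pair_notin_B[OF t]
    by (intro restrict_word_empty) auto
  moreover have a_1_eq: "a (Suc 0) = a 1" by (simp add: One_nat_def)
  moreover have "restrict_word [a 2, a 1] X = []" if "t \<noteq> 1"
    using that X t two_le_h a_first_eq_iff[OF t]
    by (intro restrict_word_empty) auto
  ultimately show ?thesis
    using restrict_last_pairs[OF t, of X] le_infI1[OF X] a_1_eq
    unfolding last_word_eq restrict_word_append[of "[a 2, a 1]"]
      restrict_word_append[of "rev (U 1)"]
    by (cases "t = 1") (auto simp del: restrict_word_Cons restrict_word_append upt_Suc)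
qed

text \<open>The reversed permutation of \<open>B\<close> stands after the first pair and before all
  others. This special role of pair 1 matches the fact that its cyclic predecessor is the last
  pair.\<close>

lemma restrict_last_x_b:
  assumes t: "t \<in> {1..h}" and x: "x \<in> {a (2 * t - 1), a (2 * t)}" and b: "b \<in> B"
  shows "restrict_word (last_word a h B (W 1)) {x, b} = (if t = 1 then [x, b] else [b, x])"
proof -
  have xB: "x \<notin> B" using x_notin_B[OF t x] .
  have bA: "a i \<noteq> b" if "i \<in> {1..2 * h}" for i using b a_notin_B[OF that] by auto
  have "restrict_word (rev (U 1)) {x, b} = [b]"
    using distinct_last_blocks xB b by (intro restrict_word_eq_single) auto
  moreover have "restrict_word [a 2, a 1] {x, b} = (if t = 1 then [x] else [])"
  proof -
    have "a 1 \<noteq> b" "a 2 \<noteq> b" using two_le_h by (intro bA; simp)+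
    then show ?thesis using x a_first_eq_iff[OF t] by auto
  qed
  moreover have "restrict_word [a (2 * t), a (2 * t - 1)] {x, b} = [x]"
  proof -
    have "a (2 * t - 1) \<noteq> b" "a (2 * t) \<noteq> b" using pair_index_mem[OF t] bA by blast+
    then show ?thesis using x a_pair_eq_iff[OF t t] by auto
  qed
  moreover have X: "{x, b} \<inter> a ` {1..2 * h} \<subseteq> {a (2 * t - 1), a (2 * t)}"
    using x a_image_disjoint_B b by blast
  ultimately show ?thesis
    using restrict_last_pairs[OF t X]
    unfolding last_word_eq restrict_word_append[of "[a 2, a 1]"]
      restrict_word_append[of "rev (U 1)"]
    by (cases "t = 1") (auto simp del: restrict_word_Cons restrict_word_append upt_Suc)
qed

section \<open>Splitting \<open>w\<close> at a pair, and letters that do not alternate\<close>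

lemma w_split:
  assumes "t \<in> {1..h}"
  shows "w = concat (map (\<lambda>s. W s @ D_word a h s) [1..<t]) @ W t @ D_word a h t @
    concat (map (\<lambda>s. W s @ D_word a h s) [t + 1..<h + 1]) @ last_word a h B (W 1)"
proof -
  have "[1..<h + 1] = [1..<t] @ t # [t + 1..<h + 1]"
    using assms by (intro upt_split_at) auto
  then show ?thesis by (simp add: w_eq del: upt_Suc)
qed

lemma alternate_imp_distinct_adj_W:
  "t \<in> {1..h} \<Longrightarrow> x \<noteq> y \<Longrightarrow> alternate w x y \<Longrightarrow> distinct_adj (restrict_word (W t) {x, y})"
  using w_split[of t] by (simp add: alternate_iff_distinct_adj distinct_adj_append_iff)

text \<open>Each pair word with its \<open>D\<close>, and likewise the final word, contributes one
  of the two orders of the letters. Alternation would force the same order everywhere.\<close>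

lemma not_alternate_B:
  assumes "b \<in> B" "b' \<in> B" "b \<noteq> b'"
  shows "\<not> alternate w b b'"
proof
  assume alt: "alternate w b b'"
  let ?u = "U 1" and ?X = "{b, b'}"
  have one: "1 \<in> {1..h}" using two_le_h by simp
  note u = distinct_U[OF one] set_U[OF one]
  \<comment> \<open>\<open>c\<close> and \<open>d\<close> are the two letters in the order in which
    the first pair word lists them.\<close>
  obtain c d where cd: "{c, d} = {b, b'}" "c \<noteq> d" "restrict_word ?u ?X = [c, d]"
    using restrict_word_distinct_pair[of ?u b b'] u assms by (metis insert_commute)
  have "c \<in> {b, b'}" "d \<in> {b, b'}" unfolding cd(1)[symmetric] by simp_all
  then have cdB: "c \<in> B" "d \<in> B" using assms by auto
  have perm: "restrict_word (W s @ D_word a h s) ?X \<in> {[c, d], [d, c]}" if "s \<in> {1..h}" for s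
  proof -
    have "restrict_word (D_word a h s) ?X = []"
      using D_B assms by (intro restrict_word_empty) auto
    moreover have "restrict_word (W s) ?X = restrict_word (U s) ?X"
      using that assms by (intro restrict_W_B) auto
    moreover have "restrict_word (U s) {c, d} \<in> {[c, d], [d, c]}"
      using restrict_word_distinct_pair[of "U s" c d]
        distinct_U[OF that] set_U[OF that] cd(2) cdB by simp
    ultimately show ?thesis using cd(1) by simp
  qed
  have first: "restrict_word (W 1 @ D_word a h 1) ?X = [c, d]"
  proof -
    have "restrict_word (D_word a h 1) ?X = []"
      using D_B assms by (intro restrict_word_empty) auto
    moreover have "restrict_word (W 1) ?X = restrict_word ?u ?X"
      using one assms by (intro restrict_W_B) auto
    ultimately show ?thesis using cd by simp
  qed
  have last: "restrict_word (last_word a h B (W 1)) ?X = [d, c]"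
  proof -
    have A: "a i \<notin> ?X" if "i \<in> {1..2 * h}" for i using a_notin_B[OF that] assms by auto
    have "restrict_word (rev ?u) ?X = [d, c]"
      unfolding restrict_word_rev cd by simp
    moreover have "restrict_word [a 2, a 1] ?X = []"
      using A[of 1] A[of 2] two_le_h by auto
    moreover have "restrict_word (concat (map (\<lambda>t. [a (2 * t), a (2 * t - 1)]) [2..<h + 1])) ?X = []"
      using set_last_pairs a_image_disjoint_B assms by (intro restrict_word_empty) blast
    ultimately show ?thesis
      unfolding last_word_eq restrict_word_append[of "[a 2, a 1]"] restrict_word_append[of "rev ?u"]
      by simp
  qed
  define ls where "ls = map (\<lambda>s. restrict_word (W s @ D_word a h s) ?X) [2..<h + 1]"
  \<comment> \<open>If the first member of \<open>ls\<close> is \<open>[c, d]\<close>, the situation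
    repeats with a shorter list; if it is \<open>[d, c]\<close>, or if \<open>ls\<close> is empty,
    two letters \<open>d\<close> meet.\<close>
  have key: "\<not> distinct_adj ([c, d] @ concat ls @ [d, c])" if "set ls \<subseteq> {[c, d], [d, c]}" for ls
    using that by (induction ls) auto
  have "restrict_word w ?X = [c, d] @ concat ls @ [d, c]"
    using w_split[OF one] first last
    by (simp add: restrict_word_concat comp_def ls_def numeral_2_eq_2 del: upt_Suc)
  moreover have "set ls \<subseteq> {[c, d], [d, c]}"
    unfolding ls_def set_map image_subset_iff by (intro ballI perm) auto
  ultimately show False
    using alt key assms(3) by (simp add: alternate_iff_distinct_adj)
qed

text \<open>This is where it matters that \<open>D_word\<close> and \<open>last_word\<close> put the
  second component of a pair before the first: the next occurrence after the pair word is again the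
  second component.\<close>

lemma not_alternate_pair:
  assumes t: "t \<in> {1..h}"
  shows "\<not> alternate w (a (2 * t - 1)) (a (2 * t))"
proof
  let ?x = "a (2 * t - 1)" and ?y = "a (2 * t)"
  let ?X = "{?x, ?y}"
  assume alt: "alternate w ?x ?y"
  have ne: "?x \<noteq> ?y" using a_pair_eq_iff[OF t t] by auto
  have blk: "restrict_word u ?X = []" if "set u \<subseteq> B" for u
    using that x_notin_B[OF t, of ?x] x_notin_B[OF t, of ?y] by (intro restrict_word_empty) auto
  have W: "restrict_word (W t) ?X = [?x, ?y, ?x, ?y]"
  proof -
    have "set (P t) \<subseteq> B" "set (Q t) \<subseteq> B" "set (R t) \<subseteq> B" "set (S t) \<subseteq> B" "set (T t) \<subseteq> B"
      using blocks_distinct(2)[OF t] by auto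
    then show ?thesis by (simp add: W_def pair_word_def blk)
  qed
  have D: "restrict_word (D_word a h s) ?X \<in> {[], [?y, ?x]}" for s
  proof (cases "t \<in> set (remaining_pairs h s)")
    case True
    have d: "distinct (D_word a h s)" using distinct_D .
    have "restrict_word (map (\<lambda>t. a (2 * t)) (remaining_pairs h s)) ?X = [?y]"
      using True d t unfolding D_word_def
      by (intro restrict_word_eq_single) (auto simp: set_remaining_pairs a_pair_eq_iff)
    moreover have "restrict_word (map (\<lambda>t. a (2 * t - 1)) (remaining_pairs h s)) ?X = [?x]"
      using True d t unfolding D_word_def
      by (intro restrict_word_eq_single) (auto simp: set_remaining_pairs a_pair_eq_iff)
    ultimately show ?thesis by (simp add: D_word_def)
  next
    case False
    then have "?x \<notin> set (D_word a h s)" "?y \<notin> set (D_word a h s)"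
      using x_in_D_iff[OF t, of ?x s] x_in_D_iff[OF t, of ?y s] t by (auto simp: set_remaining_pairs)
    then show ?thesis by (simp add: restrict_word_empty)
  qed
  have W': "restrict_word (W s) ?X = []" if "s \<in> {1..h}" "s \<noteq> t" for s
    using that x_in_W_iff[OF t, of ?x s] x_in_W_iff[OF t, of ?y s]
    by (intro restrict_word_empty) auto
  have last: "restrict_word (last_word a h B (W 1)) ?X = [?y, ?x]"
    using restrict_last_a[OF t, of ?X] by simp
  \<comment> \<open>The contributions between the pair word of \<open>t\<close> and the final word.
    The blocks before \<open>t\<close> are cut off, since \<open>distinct_adj\<close> passes to
    suffixes.\<close>
  define ls where "ls = restrict_word (D_word a h t) ?X #
    map (\<lambda>s. restrict_word (W s @ D_word a h s) ?X) [t + 1..<h + 1]"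
  \<comment> \<open>Empty members of \<open>ls\<close> are skipped; whatever comes next starts with
    \<open>?y\<close>, directly after the \<open>?y\<close> that ends the pair word.\<close>
  have key: "\<not> distinct_adj ([?x, ?y, ?x, ?y] @ concat ls @ [?y, ?x])"
    if "set ls \<subseteq> {[], [?y, ?x]}" for ls
    using that by (induction ls) auto
  have "set ls \<subseteq> {[], [?y, ?x]}"
    using D W' t by (auto simp: ls_def)
  then have "\<not> distinct_adj ([?x, ?y, ?x, ?y] @ concat ls @ [?y, ?x])"
    by (rule key)
  moreover have "distinct_adj ([?x, ?y, ?x, ?y] @ concat ls @ [?y, ?x])"
  proof -
    have eq: "restrict_word w ?X = restrict_word (concat (map (\<lambda>s. W s @ D_word a h s) [1..<t])) ?X @
      [?x, ?y, ?x, ?y] @ concat ls @ [?y, ?x]"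
      using w_split[OF t] W last
      by (simp add: restrict_word_concat comp_def ls_def del: upt_Suc)
    have "distinct_adj (restrict_word w ?X)"
      using alt alternate_iff_distinct_adj[OF ne] by blast
    from this[unfolded eq] show ?thesis
      by (rule distinct_adj_appendD2)
  qed
  ultimately show False ..
qed

lemma pair_of_index:
  assumes "i \<in> {1..2 * h}"
  obtains t where "t \<in> {1..h}" "a i \<in> {a (2 * t - 1), a (2 * t)}"
proof
  \<comment> \<open>Rounding \<open>i / 2\<close> up sends both \<open>2 * t - 1\<close> and
    \<open>2 * t\<close> to \<open>t\<close>.\<close>
  show "(i + 1) div 2 \<in> {1..h}" using assms by auto
  show "a i \<in> {a (2 * ((i + 1) div 2) - 1), a (2 * ((i + 1) div 2))}"
    by (cases "even i") (auto simp: One_nat_def elim!: evenE oddE)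
qed

lemma not_alternate_A:
  assumes "i \<in> {1..2 * h}" "j \<in> {1..2 * h}" "a i \<noteq> a j"
  shows "\<not> alternate w (a i) (a j)"
proof -
  obtain t where t: "t \<in> {1..h}" "a i \<in> {a (2 * t - 1), a (2 * t)}"
    using pair_of_index[OF assms(1)] .
  obtain t' where t': "t' \<in> {1..h}" "a j \<in> {a (2 * t' - 1), a (2 * t')}"
    using pair_of_index[OF assms(2)] .
  show ?thesis
  proof (cases "t = t'")
    case True
    then show ?thesis
      using not_alternate_pair[OF t(1)] t t' assms(3)
        alternate_commute[of w "a (2 * t - 1)" "a (2 * t)"] by auto
  next
    case False
    then have "a j \<notin> set (W t)" using x_in_W_iff[OF t', of t] t by simp
    then have "restrict_word (W t) {a i, a j} = restrict_word (W t) {a i}"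
      by (auto simp: restrict_word_def intro!: filter_cong)
    then show ?thesis
      using restrict_W_x[OF t] alternate_imp_distinct_adj_W[OF t(1) assms(3)] by auto
  qed
qed

text \<open>For adjacent letters, the additional \<open>x\<close> in the pair word of
  \<open>t\<close> is balanced by the \<open>x\<close> missing from the \<open>D\<close> just before
  it, cyclically. So \<open>b\<close> and \<open>x b x\<close> together read like two ordinary
  contributions \<open>b x\<close>. For \<open>t = 1\<close> this balance runs around the ends of
  the word, which is why that case is separate.\<close>

lemma alternate_a_b_iff:
  assumes i: "i \<in> {1..2 * h}" and b: "b \<in> B"
  shows "alternate w (a i) b \<longleftrightarrow> b \<in> nbhd G (a i)"
proof -
  define x where "x = a i"
  obtain t where t: "t \<in> {1..h}" and x: "x \<in> {a (2 * t - 1), a (2 * t)}"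
    using pair_of_index[OF i] unfolding x_def .
  have xB: "x \<notin> B" using x_notin_B[OF t x] .
  then have xb: "x \<noteq> b" using b by auto
  have "alternate w x b" if nb: "b \<in> nbhd G x"
  proof -
    have D: "restrict_word (D_word a h s) {x, b} = (if t \<noteq> s \<and> t \<noteq> succ s then [x] else [])" for s
    proof (cases "t \<noteq> s \<and> t \<noteq> succ s")
      case True
      then have "set (D_word a h s) \<inter> {x, b} = {x}"
        using x_in_D_iff[OF t x, of s] D_B b by auto
      then show ?thesis using True distinct_D[of s] by (simp add: restrict_word_eq_single)
    next
      case False
      then have "set (D_word a h s) \<inter> {x, b} = {}"
        using x_in_D_iff[OF t x, of s] D_B b by auto
      then show ?thesis using False by (auto simp add: restrict_word_empty)
    qed
    have W: "restrict_word (W s) {x, b} = (if s = t then [x, b, x] else [b])" if s: "s \<in> {1..h}" for s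
    proof (cases "s = t")
      case True
      then show ?thesis using restrict_W_x_b[OF t x b] nb by simp
    next
      case False
      then have "restrict_word (W s) {x, b} = restrict_word (W s) {b}"
        using x_in_W_iff[OF t x s] by (auto simp: restrict_word_def intro!: filter_cong)
      also have "\<dots> = [b]"
        using restrict_W_single[OF s b] .
      finally show ?thesis using False by simp
    qed
    let ?c = "\<lambda>s. restrict_word (W s @ D_word a h s) {x, b}"
    have w_restrict: "restrict_word w {x, b} = concat (map ?c [1..<h + 1]) @
        (if t = 1 then [x, b] else [b, x])"
      using restrict_last_x_b[OF t x b] by (simp add: w_eq restrict_word_concat comp_def del: upt_Suc)
    have c: "?c s = [b, x]" if "s \<in> {1..h}" "s \<noteq> t" "t \<noteq> succ s" for s
      using W[OF that(1)] D[of s] that by simp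
    have ct: "?c t = [x, b, x]"
      using W[OF t] D[of t] by simp
    \<comment> \<open>Covers the runs of ordinary blocks; an empty range gives the empty
      word.\<close>
    have conc: "concat (map ?c [k..<l]) = alt_word b x (2 * (l - k))"
      if "\<And>s. s \<in> {k..<l} \<Longrightarrow> s \<in> {1..h} \<and> s \<noteq> t \<and> t \<noteq> succ s" for k l
    proof -
      have "concat (map ?c [k..<l]) = alt_word b x (2 * length [k..<l])"
        by (rule concat_map_const_alt_word) (use that c in auto)
      then show ?thesis by simp
    qed
    show ?thesis
    proof (cases "t = 1")
      case True
      have split: "[1..<h + 1] = [1] @ [2..<h] @ [h]"
        using two_le_h upt_split_at[of 1 1 h] by (simp add: upt_split_at[of 1 h "h + 1"])
      have ch: "?c h = [b]"
        using W[of h] D[of h] True two_le_h by simp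
      have "concat (map ?c [2..<h]) = alt_word b x (2 * (h - 2))"
        using True by (intro conc) auto
      \<comment> \<open>Block 1 gives \<open>x b x\<close>, split as \<open>x\<close> and
        \<open>b x\<close>. Block \<open>h\<close>, the predecessor of pair 1, gives
        \<open>b\<close>, which joins the final \<open>x b\<close> to form
        \<open>alt_word b x 3\<close>.\<close>
      then have "restrict_word w {x, b} =
          [x] @ alt_word b x (2 * 1) @ alt_word b x (2 * (h - 2)) @ alt_word b x 3"
        unfolding w_restrict split using True ct ch by (simp add: numeral_eq_Suc)
      also have "\<dots> = alt_word x b (Suc (2 * 1 + (2 * (h - 2) + 3)))"
        unfolding alt_word_even_append by (simp only: alt_word.simps append.simps)
      finally show ?thesis unfolding alternate_def by blast
    next
      case False
      then have t2: "2 \<le> t" "t \<le> h" using t by auto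
      have split: "[1..<h + 1] = [1..<t - 1] @ [t - 1, t] @ [t + 1..<h + 1]"
      proof -
        have "[1..<h + 1] = [1..<t - 1] @ (t - 1) # [t - 1 + 1..<h + 1]"
          using t2 by (intro upt_split_at) auto
        moreover have "[t..<h + 1] = t # [t + 1..<h + 1]"
          using t2 upt_split_at[of t t "h + 1"] by simp
        ultimately show ?thesis using t2 by simp
      qed
      have cp: "?c (t - 1) = [b]"
        using W[of "t - 1"] D[of "t - 1"] t2 by auto
      have "concat (map ?c [1..<t - 1]) = alt_word b x (2 * (t - 1 - 1))"
        using t2 by (intro conc) auto
      moreover have "concat (map ?c [t + 1..<h + 1]) = alt_word b x (2 * (h + 1 - (t + 1)))"
        using t2 by (intro conc) auto
      \<comment> \<open>The blocks \<open>t - 1\<close> and \<open>t\<close> give \<open>b\<close>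
        and \<open>x b x\<close>, that is \<open>alt_word b x (2 * 2)\<close>; the final word adds
        \<open>b x\<close>.\<close>
      ultimately have "restrict_word w {x, b} = alt_word b x (2 * (t - 1 - 1)) @
          alt_word b x (2 * 2) @ alt_word b x (2 * (h + 1 - (t + 1))) @ alt_word b x 2"
        unfolding w_restrict split using False ct cp
        by (simp add: numeral_eq_Suc del: upt_Suc restrict_word_append)
      then show ?thesis
        unfolding alternate_def alt_word_even_append by blast
    qed
  qed
  moreover have "b \<in> nbhd G x" if "alternate w x b"
  proof (rule ccontr)
    assume "b \<notin> nbhd G x"
    then have "restrict_word (W t) {x, b} \<in> {[b, x, x], [x, x, b]}"
      using restrict_W_x_b[OF t x b] by auto
    then show False
      using alternate_imp_distinct_adj_W[OF t xb that] by auto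
  qed
  ultimately show ?thesis unfolding x_def by blast
qed

section \<open>Uniformity and the set of letters\<close>

lemma count_w_b:
  assumes b: "b \<in> B"
  shows "count_list w b = 1 + h"
proof -
  have "count_list (last_word a h B (W 1)) b = 1"
  proof -
    have A: "a i \<noteq> b" if "i \<in> {1..2 * h}" for i using a_notin_B[OF that] b by auto
    have "b \<notin> set (concat (map (\<lambda>t. [a (2 * t), a (2 * t - 1)]) [2..<h + 1]))"
      using set_last_pairs a_image_disjoint_B b by blast
    moreover have "a 1 \<noteq> b" "a 2 \<noteq> b"
      using two_le_h by (intro A; simp)+
    ultimately show ?thesis
      using count_list_distinct[OF distinct_last_blocks(1), of b] distinct_last_blocks(2) b
      unfolding last_word_eq
      by (simp add: count_list_0_iff del: rev_append upt_Suc)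
  qed
  moreover have "count_list (W s @ D_word a h s) b = 1" if "s \<in> {1..h}" for s
  proof -
    have "b \<notin> set (D_word a h s)" using D_B b by auto
    then show ?thesis using count_W_B[OF that b] by simp
  qed
  then have "(\<Sum>s\<leftarrow>[1..<h + 1]. count_list (W s @ D_word a h s) b) = (\<Sum>s\<leftarrow>[1..<h + 1]. 1)"
    by (intro arg_cong[of _ _ sum_list] map_cong) auto
  ultimately show ?thesis
    unfolding w_eq count_list_append count_list_concat map_map comp_def
    by (simp add: sum_list_triv del: upt_Suc)
qed

text \<open>A letter of pair \<open>t\<close> occurs once in each block, except twice in block
  \<open>t\<close> and not at all in the block cyclically before it; the final word adds one
  occurrence.\<close>

lemma count_w_a:
  assumes i: "i \<in> {1..2 * h}"
  shows "count_list w (a i) = 1 + h"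
proof -
  define x where "x = a i"
  obtain t where t: "t \<in> {1..h}" and x: "x \<in> {a (2 * t - 1), a (2 * t)}"
    using pair_of_index[OF i] unfolding x_def .
  \<comment> \<open>\<open>p\<close> is the cyclic predecessor of \<open>t\<close>, the other index
    whose \<open>D\<close> omits pair \<open>t\<close>.\<close>
  define p where "p = (if t = 1 then h else t - 1)"
  have p: "p \<in> {1..h}" "p \<noteq> t" and succ_iff: "t = succ s \<longleftrightarrow> s = p" if "s \<in> {1..h}" for s
    using that t two_le_h by (auto simp: p_def)
  have W: "count_list (W s) x = (if s = t then 2 else 0)" if "s \<in> {1..h}" for s
    using count_list_restrict[of x "{x}" "W s"] restrict_W_x[OF t x] x_in_W_iff[OF t x that]
    by (auto simp: count_list_0_iff)
  \<comment> \<open>The deficit at \<open>p\<close> is added on the left, which avoids subtraction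
    on natural numbers; after summation both correction terms contribute 1 and cancel.\<close>
  have "count_list (W s @ D_word a h s) x + (if s = p then 1 else 0) = 1 + (if s = t then 1 else 0)"
    if "s \<in> {1..h}" for s
    using W[OF that] count_list_distinct[OF distinct_D, of s x] x_in_D_iff[OF t x, of s]
      succ_iff[OF that] p(2)[OF that] by auto
  then have "(\<Sum>s\<in>{1..h}. count_list (W s @ D_word a h s) x + (if s = p then 1 else 0)) =
      (\<Sum>s\<in>{1..h}. 1 + (if s = t then 1 else 0))"
    by (intro sum.cong) auto
  then have "(\<Sum>s\<in>{1..h}. count_list (W s @ D_word a h s) x) = h"
    using t p[OF t] by (simp only: sum.distrib) (simp add: sum.delta)
  moreover have "count_list (last_word a h B (W 1)) x = 1"
    using restrict_last_a[OF t, of "{x}"] x a_pair_eq_iff[OF t t]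
      count_list_restrict[of x "{x}" "last_word a h B (W 1)"] by auto
  moreover have "(\<Sum>s\<leftarrow>[1..<h + 1]. f s) = (\<Sum>s\<in>{1..h}. f s)" for f :: "nat \<Rightarrow> nat"
    by (subst sum_list_distinct_conv_sum_set)
       (simp_all only: distinct_upt set_upt Suc_eq_plus1[symmetric] atLeastLessThanSuc_atLeastAtMost)
  ultimately show ?thesis
    unfolding w_eq count_list_append count_list_concat map_map comp_def x_def by simp
qed

lemma set_w: "set w = a ` {1..2 * h} \<union> B"
proof
  have W: "set (W s) \<subseteq> a ` {1..2 * h} \<union> B" if "s \<in> {1..h}" for s
    using pair_index_mem[OF that] by (auto simp: set_W[OF that])
  have D: "set (D_word a h s) \<subseteq> a ` {1..2 * h}" for s
    using pair_index_mem by (auto simp: D_word_def set_remaining_pairs)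
  have last: "set (last_word a h B (W 1)) \<subseteq> a ` {1..2 * h} \<union> B"
  proof -
    have "a 1 \<in> a ` {1..2 * h}" "a 2 \<in> a ` {1..2 * h}"
      using two_le_h by auto
    moreover have "set (rev (U 1)) = B" by (rule distinct_last_blocks)
    ultimately show ?thesis
      unfolding last_word_eq set_append list.set using set_last_pairs by blast
  qed
  have "set (W s @ D_word a h s) \<subseteq> a ` {1..2 * h} \<union> B" if "s \<in> set [1..<h + 1]" for s
  proof -
    have "s \<in> {1..h}" using that by auto
    from W[OF this] D show ?thesis unfolding set_append by blast
  qed
  then have "set (concat (map (\<lambda>s. W s @ D_word a h s) [1..<h + 1])) \<subseteq> a ` {1..2 * h} \<union> B"
    unfolding set_concat set_map image_image by (rule UN_least)
  with last show "set w \<subseteq> a ` {1..2 * h} \<union> B"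
    unfolding w_eq set_append by (rule Un_least[rotated])
  \<comment> \<open>The remaining inclusion follows from the counts, because \<open>1 + h\<close> is
    positive.\<close>
  have "y \<in> set w" if "count_list w y = 1 + h" for y
    using that count_notin[of y w] by linarith
  then show "a ` {1..2 * h} \<union> B \<subseteq> set w"
    using count_w_a count_w_b by blast
qed

lemma uniform_w: "uniform_word (1 + h) w"
  unfolding uniform_word_def
proof
  fix x assume "x \<in> set w"
  then consider i where "i \<in> {1..2 * h}" "x = a i" | "x \<in> B"
    unfolding set_w by blast
  then show "count_list w x = 1 + h"
    by cases (simp_all only: count_w_a count_w_b)
qed

lemma represents_w:
  assumes "bipartite_with G (a ` {1..2 * h}) B" and "sym (parcs G)"
  shows "represents w G"
proof -
  have V: "pverts G = a ` {1..2 * h} \<union> B"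
    and E: "\<And>x y. (x, y) \<in> parcs G \<Longrightarrow>
      x \<in> a ` {1..2 * h} \<and> y \<in> B \<or> x \<in> B \<and> y \<in> a ` {1..2 * h}"
    using assms(1) by (auto simp: bipartite_with_def)
  have ab: "(a i, b) \<in> parcs G \<longleftrightarrow> alternate w (a i) b" if "i \<in> {1..2 * h}" "b \<in> B" for i b
    using alternate_a_b_iff[OF that] by (simp add: nbhd_def)
  have ba: "(b, a i) \<in> parcs G \<longleftrightarrow> alternate w b (a i)" if "i \<in> {1..2 * h}" "b \<in> B" for i b
    using ab[OF that] assms(2) alternate_commute[of w b "a i"] by (auto dest: symD)
  show ?thesis
    unfolding represents_def
  proof (intro conjI ballI impI)
    show "set w = pverts G" using set_w V by simp
    fix x y assume "x \<in> pverts G" "y \<in> pverts G" and ne: "x \<noteq> y"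
    then consider i j where "i \<in> {1..2 * h}" "j \<in> {1..2 * h}" "x = a i" "y = a j"
      | i where "i \<in> {1..2 * h}" "x = a i" "y \<in> B"
      | i where "i \<in> {1..2 * h}" "y = a i" "x \<in> B"
      | "x \<in> B" "y \<in> B"
      unfolding V by blast
    then show "(x, y) \<in> parcs G \<longleftrightarrow> alternate w x y"
    proof cases
      case 1
      then have "x \<notin> B" "y \<notin> B" using a_notin_B by auto
      then show ?thesis using 1 ne not_alternate_A E by blast
    next
      case 4
      then have "x \<notin> a ` {1..2 * h}" "y \<notin> a ` {1..2 * h}" using a_image_disjoint_B by auto
      then show ?thesis using 4 ne not_alternate_B E by blast
    qed (use ab ba in auto)
  qed
qed

end

text \<open>Only the parity adjustment is left: the locale is instantiated with \<open>G'\<close>,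
  where a possible extra letter \<open>a (m + 1)\<close> is one more member of the enumerated
  part.\<close>

theorem theorem1:
  fixes G G' :: "'v pair_pre_digraph"
    and A B :: "'v set"
    and a b :: "nat \<Rightarrow> 'v"
    and m n M :: nat
    and P Q R S T :: "nat \<Rightarrow> 'v list"
  assumes "pair_graph G"
    and "Digraph_Component.connected (with_proj G)"
    and "reduced G"
    and "bipartite_with G A B"
    and "bij_betw a {1..m} A"
    and "bij_betw b {1..n} B"
    and "m \<le> n"
    and "3 \<le> m"
    and "odd m \<Longrightarrow> a (m + 1) \<notin> pverts G"
    and "M = (if even m then m else m + 1)"
    and "G' = (if even m then G else add_isolated (a (m + 1)) G)"
    and "\<And>s. s \<in> {1..M div 2} \<Longrightarrow>
           pair_blocks G' B (a (2 * s - 1)) (a (2 * s)) (P s) (Q s) (R s) (S s) (T s)"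
  shows "uniform_word (1 + M div 2) (full_word a (M div 2) B P Q R S T) \<and>
         represents (full_word a (M div 2) B P Q R S T) G'"
proof -
  define h where "h = M div 2"
  \<comment> \<open>The smallest case \<open>m = 3\<close> is rounded up to \<open>M = 4\<close>, so
    \<open>3 \<le> m\<close> yields two pairs.\<close>
  have M: "2 * h = M" and h: "2 \<le> h"
    using assms(8,10) by (auto simp: h_def elim!: evenE oddE)
  have aA: "a ` {1..m} = A" and inj: "inj_on a {1..m}"
    using assms(5) by (auto simp: bij_betw_def)
  have bip: "pverts G = A \<union> B" "A \<inter> B = {}"
    "\<forall>(x, y)\<in>parcs G. (x \<in> A \<and> y \<in> B) \<or> (x \<in> B \<and> y \<in> A)"
    using assms(4) by (auto simp: bipartite_with_def)
  have parcs: "parcs G' = parcs G"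
    using assms(11) by (simp add: add_isolated_def)
  have Msplit: "{1..2 * h} = (if even m then {1..m} else insert (m + 1) {1..m})"
    using M assms(10) by auto
  have bip': "bipartite_with G' (a ` {1..2 * h}) B"
    using bip aA assms(9,11) unfolding Msplit bipartite_with_def parcs
    by (auto simp: add_isolated_def)
  \<comment> \<open>For odd \<open>m\<close> the letter \<open>a (m + 1)\<close> is fresh, hence
    differs from all earlier ones.\<close>
  have inj': "inj_on a {1..2 * h}"
    using inj aA assms(9) bip(1) unfolding Msplit by (auto simp: inj_on_insert)
  have "a i \<notin> B" if "i \<in> {1..2 * h}" for i
    using bip' that unfolding bipartite_with_def by blast
  moreover from this have "nbhd G' (a i) \<subseteq> B" if "i \<in> {1..2 * h}" for i
    using bip' that by (fastforce simp: bipartite_with_def nbhd_def)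
  ultimately interpret pair_construction G' B a h P Q R S T
    using h inj' assms(12) by unfold_locales (simp_all add: h_def)
  have "sym (parcs G')"
    using pair_graph.axioms(2)[OF assms(1)] unfolding parcs
    by (auto simp: sym_def pair_pseudo_graph_def intro: pair_sym_digraph.arcs_symmetric)
  then show ?thesis
    using uniform_w represents_w[OF bip'] unfolding h_def by simp
qed

end
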